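(* Let $n,k$ be integers such that $n>0$ and $0\le k\le n-1$. Then $$z(n,k,0)=T(n-1,k)=\binom{\left\lfloor \frac{n+k-1}{2}\right\rfloor}{k}.$$
   Context: A binary string of length $n$ is a sequence $b_1b_2\cdots b_n$ with each $b_i\in\{0,1\}$. A 0-pair (resp. 1-pair) of the string is an index $i$ with $1\le i\le n-1$ and $b_i=b_{i+1}=0$ (resp. $b_i=b_{i+1}=1$); the first and last bits are not considered consecutive. For integers $n\ge 0$ and $k,m\ge 0$, $Z(n,k,m)$ is the set of binary strings of length $n$ whose first bit is 0 and which have exactly $k$ 0-pairs and exactly $m$ 1-pairs, and $z(n,k,m)=|Z(n,k,m)|$ (so $z(0,k,m)=0$, since the empty string has no first bit). By convention $z(n,k,m)=0$ whenever $n<0$, $k<0$ or $m<0$. For integers $n\ge 0$ and $0\le k\le n$, $T(n,k)$ is defined by $T(n,k)=\binom{\lfloor (n+k)/2\rfloor}{k}$. *)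

theory Defs
  imports Complex_Main
begin

definition binary_string :: "nat \<Rightarrow> nat list \<Rightarrow> bool" where
  "binary_string n w \<longleftrightarrow> length w = n \<and> set w \<subseteq> {0, 1}"

text \<open>The string \<open>b\<^sub>1 \<dots> b\<^sub>n\<close> is a list, so the 1-based bit \<open>b\<^sub>i\<close> is \<open>w ! (i - 1)\<close>. Here
  \<open>i < length w\<close> stands for \<open>i \<le> n - 1\<close>, to avoid truncated subtraction at \<open>n = 0\<close>.\<close>

definition pairs :: "nat \<Rightarrow> nat list \<Rightarrow> nat set" where
  "pairs c w = {i. 1 \<le> i \<and> i < length w \<and> w ! (i - 1) = c \<and> w ! i = c}"

definition Z :: "nat \<Rightarrow> nat \<Rightarrow> nat \<Rightarrow> nat list set" where
  "Z n k m = {w. binary_string n w \<and> w \<noteq> [] \<and> hd w = 0 \<and>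
                 card (pairs 0 w) = k \<and> card (pairs 1 w) = m}"

definition z :: "int \<Rightarrow> int \<Rightarrow> int \<Rightarrow> nat" where
  "z n k m = (if n < 0 \<or> k < 0 \<or> m < 0 then 0 else card (Z (nat n) (nat k) (nat m)))"

text \<open>\<open>T n k\<close> is meaningful only for \<open>0 \<le> k \<le> n\<close>; its values elsewhere are irrelevant.\<close>

definition T :: "int \<Rightarrow> int \<Rightarrow> nat" where
  "T n k = nat \<lfloor>real_of_int (n + k) / 2\<rfloor> choose nat k"

end

theory Submission
  imports Defs
begin

text \<open>
  A string without 1-pairs that starts with 0 can be shortened in a unique way: the leading 0, if
  it is not the whole string, is followed by another 0, or by a 1, and that 1 can only be followed
  by a 0 or by the end of the string. Removing the leading 0 in the first case costs one 0-pair;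
  removing the leading block 01 in the second case costs none. In both cases what remains is again
  such a string, so the counts satisfy \<open>a (n + 2) k = a (n + 1) (k - 1) + a n k\<close>,
  without the first summand if \<open>k = 0\<close> (lemmas \<open>zero_led_add_2\<close> and
  \<open>card_zero_led_add_2\<close>). The claimed formula \<open>a n k = \<lfloor>(n + k - 1) /
  2\<rfloor> choose k\<close> depends on \<open>n\<close> and \<open>k\<close> in such a way that
  both summands have the same upper index \<open>\<lfloor>(n + k - 1) / 2\<rfloor>\<close>, and
  the left-hand side has that index plus 1: the recurrence is Pascal's rule.

  The block 01 may be the whole string, so the recurrence needs the empty string as a base case
  with count 1. This is the reason for working with the family \<open>zero_led\<close>, which
  admits the empty string, instead of \<open>Z n k 0\<close>, which excludes it.
\<close>

lemma pairs_short [simp]: "pairs c [] = {}" "pairs c [a] = {}"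
  by (auto simp: pairs_def)

lemma finite_pairs: "finite (pairs c w)"
  by (rule finite_subset[of _ "{..<length w}"]) (auto simp: pairs_def)

lemma pairs_Cons_Cons:
  "pairs c (a # b # w) = (if a = c \<and> b = c then {1} else {}) \<union> Suc ` pairs c (b # w)"
proof (rule set_eqI)
  fix i
  show "i \<in> pairs c (a # b # w) \<longleftrightarrow>
        i \<in> (if a = c \<and> b = c then {1} else {}) \<union> Suc ` pairs c (b # w)"
  proof (cases i)
    case 0
    then show ?thesis by (auto simp: pairs_def)
  next
    case (Suc j)
    then show ?thesis by (cases j) (auto simp: pairs_def)
  qed
qed

lemma card_pairs_Cons_Cons:
  "card (pairs c (a # b # w)) = (if a = c \<and> b = c then 1 else 0) + card (pairs c (b # w))"
proof -
  have "1 \<notin> Suc ` pairs c (b # w)"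
    by (auto simp: pairs_def)
  then show ?thesis
    by (auto simp: pairs_Cons_Cons finite_pairs card_image)
qed

definition zero_led :: "nat \<Rightarrow> nat \<Rightarrow> nat list set" where
  "zero_led n k = {w. binary_string n w \<and> (w = [] \<or> hd w = 0) \<and>
                      card (pairs 0 w) = k \<and> card (pairs 1 w) = 0}"

lemma Z_eq_zero_led: "n > 0 \<Longrightarrow> Z n k 0 = zero_led n k"
  by (auto simp: Z_def zero_led_def binary_string_def)

lemma finite_zero_led: "finite (zero_led n k)"
  by (rule finite_subset[OF _ finite_lists_length_eq[of "{0, 1}" n]])
     (auto simp: zero_led_def binary_string_def)

lemma zero_led_0: "zero_led 0 k = (if k = 0 then {[]} else {})"
  by (auto simp: zero_led_def binary_string_def)

lemma zero_led_1: "zero_led 1 k = (if k = 0 then {[0]} else {})"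
  by (auto simp: zero_led_def binary_string_def length_Suc_conv)

lemma zero_zero_in_zero_led_iff:
  "0 # 0 # v \<in> zero_led (Suc n) k \<longleftrightarrow> k > 0 \<and> 0 # v \<in> zero_led n (k - 1)"
  by (auto simp: zero_led_def binary_string_def card_pairs_Cons_Cons)

text \<open>Since 1-pairs are forbidden, the bit after the block 01, if there is one, must be 0; so what
  follows the block is itself a string of the family, and no pair straddles the boundary.\<close>

lemma zero_one_in_zero_led_iff:
  "0 # 1 # v \<in> zero_led (Suc (Suc n)) k \<longleftrightarrow> v \<in> zero_led n k"
  by (cases v) (auto simp: zero_led_def binary_string_def card_pairs_Cons_Cons)

lemma zero_led_add_2:
  "zero_led (Suc (Suc n)) k =
     (if k = 0 then {} else (#) 0 ` zero_led (Suc n) (k - 1)) \<union>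
     (\<lambda>v. 0 # 1 # v) ` zero_led n k"
  (is "_ = ?A \<union> ?B")
proof (rule set_eqI)
  fix w
  show "w \<in> zero_led (Suc (Suc n)) k \<longleftrightarrow> w \<in> ?A \<union> ?B"
  proof (cases "\<exists>b v. w = 0 # b # v \<and> b \<in> {0, 1}")
    case True
    then obtain b v where w: "w = 0 # b # v" and "b \<in> {0, 1}"
      by blast
    then consider "b = 0" | "b = 1"
      by auto
    moreover have "1 # v \<notin> zero_led (Suc n) (k - 1)"
      by (simp add: zero_led_def)
    ultimately show ?thesis
      using w zero_zero_in_zero_led_iff[of v "Suc n" k] zero_one_in_zero_led_iff[of v n k]
      by cases auto
  next
    case False
    moreover have "\<exists>b v. w = 0 # b # v \<and> b \<in> {0, 1}" if "w \<in> zero_led (Suc (Suc n)) k"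
      using that by (auto simp: zero_led_def binary_string_def length_Suc_conv)
    moreover have "\<exists>v. u = 0 # v" if "u \<in> zero_led (Suc n) (k - 1)" for u
      using that by (auto simp: zero_led_def binary_string_def length_Suc_conv)
    ultimately show ?thesis
      by (fastforce split: if_splits)
  qed
qed

lemma card_zero_led_add_2:
  "card (zero_led (Suc (Suc n)) k) =
     (if k = 0 then 0 else card (zero_led (Suc n) (k - 1))) + card (zero_led n k)"
proof -
  have "0 # 1 # v \<notin> (#) 0 ` zero_led (Suc n) (k - 1)" for v
    by (auto simp: zero_led_def)
  then have "(if k = 0 then {} else (#) 0 ` zero_led (Suc n) (k - 1)) \<inter>
             (\<lambda>v. 0 # 1 # v) ` zero_led n k = {}"
    by auto
  then show ?thesis
    unfolding zero_led_add_2
    by (subst card_Un_disjoint) (auto simp: finite_zero_led card_image inj_on_def)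
qed

text \<open>For \<open>n = 0\<close> the subtraction on \<^typ>\<open>nat\<close> is truncated when \<open>k = 0\<close>, and \<open>0 choose 0 = 1\<close> counts the
  empty string. For \<open>k \<ge> n\<close> the upper index is less than \<open>k\<close> unless \<open>n = k = 0\<close>, so the binomial
  coefficient vanishes as it should.\<close>

lemma card_zero_led: "card (zero_led n k) = ((n + k - 1) div 2) choose k"
proof (induction n arbitrary: k rule: induct_nat_012)
  case 0
  have "(k - 1) div 2 < k" if "k > 0"
    using that by linarith
  then show ?case
    by (cases "k = 0") (auto simp: zero_led_0 binomial_eq_0)
next
  case 1
  have "k div 2 < k" if "k > 0"
    using that by linarith
  then show ?case
    using zero_led_1[of k] by (cases "k = 0") (auto simp: binomial_eq_0)
next
  case (ge2 n)
  show ?case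
  proof (cases k)
    case 0
    then show ?thesis
      by (simp add: card_zero_led_add_2 ge2)
  next
    case (Suc j)
    have "card (zero_led (Suc (Suc n)) k) =
            (((n + j) div 2) choose j) + (((n + j) div 2) choose Suc j)"
      by (simp add: card_zero_led_add_2 ge2 Suc)
    also have "\<dots> = Suc ((n + j) div 2) choose Suc j"
      by simp
    also have "Suc ((n + j) div 2) = (Suc (Suc n) + k - 1) div 2"
      by (simp add: Suc)
    finally show ?thesis
      by (simp add: Suc)
  qed
qed

theorem theorem3p1:
  fixes n k :: int
  assumes "n > 0" and "0 \<le> k" and "k \<le> n - 1"
  shows "z n k 0 = T (n - 1) k \<and>
         T (n - 1) k = nat \<lfloor>real_of_int (n + k - 1) / 2\<rfloor> choose nat k"
proof -
  have "\<lfloor>real_of_int (n + k - 1) / 2\<rfloor> = (n + k - 1) div 2"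
    using floor_divide_of_int_eq[of "n + k - 1" 2, where 'a = real] by simp
  moreover have "nat ((n + k - 1) div 2) = (nat n + nat k - 1) div 2"
    using assms by (simp add: nat_div_distrib nat_add_distrib nat_diff_distrib)
  moreover have "z n k 0 = card (zero_led (nat n) (nat k))"
    using assms by (simp add: z_def Z_eq_zero_led)
  moreover have "n - 1 + k = n + k - 1"
    by simp
  ultimately show ?thesis
    by (simp only: T_def card_zero_led)
qed

end
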